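(* Let $q$ be an odd prime power and $\mathcal{P}$ a set of $5q$ points in $\mathbb{F}_q^2$. Then the number of distinct radii of circles determined by $\mathcal{P}$ is at least $4q/9$.
   Context: A circle in $\mathbb{F}_q^2$ with center $\mathbf{a}=(a_1,a_2)\in\mathbb{F}_q^2$ and radius $r\in\mathbb{F}_q$ is the set $\{(x_1,x_2)\in\mathbb{F}_q^2:(x_1-a_1)^2+(x_2-a_2)^2=r\}$. A circle is determined by $\mathcal{P}$ if it passes through three non-collinear points of $\mathcal{P}$. *)

theory Defs
  imports Complex_Main "HOL-Library.Cardinality" "HOL-Number_Theory.Prime_Powers"
begin

definition circle :: "'a::field \<times> 'a \<Rightarrow> 'a \<Rightarrow> ('a \<times> 'a) set" where
  "circle a r = {(x1, x2). (x1 - fst a)\<^sup>2 + (x2 - snd a)\<^sup>2 = r}"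

definition is_line :: "('a::field \<times> 'a) set \<Rightarrow> bool" where
  "is_line L \<longleftrightarrow> (\<exists>a b c. (a, b) \<noteq> (0, 0) \<and> L = {(x, y). a * x + b * y = c})"

definition collinear_points :: "('a::field \<times> 'a) set \<Rightarrow> bool" where
  "collinear_points S \<longleftrightarrow> (\<exists>L. is_line L \<and> S \<subseteq> L)"

definition determined_by :: "('a::field \<times> 'a) set \<Rightarrow> ('a \<times> 'a) set \<Rightarrow> bool" where
  "determined_by P C \<longleftrightarrow>
     (\<exists>T. T \<subseteq> P \<and> card T = 3 \<and> \<not> collinear_points T \<and> T \<subseteq> C)"

(* As in the definition of a circle, the radius is the value r of the quadratic form
   (not a square root of it), and r = 0 is allowed. *)
definition determined_radii :: "('a::field \<times> 'a) set \<Rightarrow> 'a set" where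
  "determined_radii P = {r. \<exists>a. determined_by P (circle a r)}"

end

theory Submission
  imports Defs "HOL-Number_Theory.Residues"
begin

text \<open>
  Over a field with \<open>q\<close> elements, \<open>q\<close> odd, there are \<open>q\<^sup>3\<close> pairs (centre, radius); every point lies
  on \<open>q\<^sup>2\<close> of the corresponding circles, and every two points lie on \<open>q\<close> of them. Hence the number
  \<open>N\<close> of points of \<open>P\<close> on a circle has mean \<open>5\<close>, and the sum of \<open>(N - 5)\<^sup>2\<close> is \<open>5q\<^sup>3 - 5q\<^sup>2\<close>. As in
  Chebyshev's inequality, \<open>N \<le> 2\<close> for at most \<open>5q\<^sup>3/9\<close> circles, so \<open>N \<ge> 3\<close> for at least \<open>4q\<^sup>3/9\<close> of
  them; each radius accounts for at most \<open>q\<^sup>2\<close>.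

  Three points on a circle of nonzero radius are not collinear. A circle of radius \<open>0\<close> has a second
  point only if \<open>-1\<close> is a square; then it is a pair of lines, and since \<open>P\<close> has more than \<open>q\<close>
  points, some such pair contains three non-collinear points of \<open>P\<close>, so that \<open>0\<close> is a determined
  radius.
\<close>

section \<open>Odd characteristic, lines, and circles through one or two points\<close>

lemma two_neq_zero_if_odd_card:
  assumes "odd CARD('a::{field,finite})"
  shows "(2::'a) \<noteq> 0"
proof
  assume "(2::'a) = 0"
  then have "CHAR('a) dvd 2"
    by (metis of_nat_numeral of_nat_eq_0_iff_char_dvd)
  then have "CHAR('a) = 2"
    using two_is_prime_nat CHAR_not_1'[where 'a='a] by (auto simp: prime_nat_iff)
  then show False
    using CHAR_dvd_CARD[where 'a='a] assms by simp
qed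

lemma card_line:
  fixes a b c :: "'a::{field,finite}"
  assumes "(a, b) \<noteq> (0, 0)"
  shows "card {(x, y). a * x + b * y = c} = CARD('a)"
proof (cases "b = 0")
  case False
  then have "bij_betw (\<lambda>x. (x, (c - a * x) / b)) UNIV {(x, y). a * x + b * y = c}"
    by (intro bij_betwI[of _ _ _ fst]) (auto simp: field_simps)
  then show ?thesis by (simp add: bij_betw_same_card)
next
  case True
  with assms have "bij_betw (\<lambda>y. ((c - b * y) / a, y)) UNIV {(x, y). a * x + b * y = c}"
    by (intro bij_betwI[of _ _ _ snd]) (auto simp: field_simps)
  then show ?thesis by (simp add: bij_betw_same_card)
qed

text \<open>The centre is free and fixes the radius. Circles are counted as pairs of centre and
  radius, not as point sets.\<close>

lemma card_circles_through_point:
  fixes p :: "'a::{field,finite} \<times> 'a"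
  shows "card {c. p \<in> circle (fst c) (snd c)} = CARD('a) ^ 2"
proof -
  have "bij_betw (\<lambda>a. (a, (fst p - fst a)\<^sup>2 + (snd p - snd a)\<^sup>2)) UNIV
          {c. p \<in> circle (fst c) (snd c)}"
    by (intro bij_betwI[of _ _ _ fst]) (auto simp: circle_def case_prod_beta)
  then have "card {c. p \<in> circle (fst c) (snd c)} = CARD('a \<times> 'a)"
    by (rule bij_betw_same_card[symmetric])
  then show ?thesis by (simp add: power2_eq_square)
qed

text \<open>The centre must lie on the perpendicular bisector \<open>?L\<close>, which is a line
  because \<open>2 \<noteq> 0\<close> and the points differ; the radius then follows from the
  centre.\<close>

lemma card_circles_through_two_points:
  fixes p p' :: "'a::{field,finite} \<times> 'a"
  assumes two: "(2::'a) \<noteq> 0" and "p \<noteq> p'"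
  shows "card {c. p \<in> circle (fst c) (snd c) \<and> p' \<in> circle (fst c) (snd c)} = CARD('a)"
proof -
  obtain x y x' y' where p: "p = (x, y)" "p' = (x', y')" by (metis surj_pair)
  let ?L = "{(u, v). (2 * (x - x')) * u + (2 * (y - y')) * v = x\<^sup>2 + y\<^sup>2 - x'\<^sup>2 - y'\<^sup>2}"
  have bis: "(x' - u)\<^sup>2 + (y' - v)\<^sup>2 = (x - u)\<^sup>2 + (y - v)\<^sup>2 \<longleftrightarrow> (u, v) \<in> ?L" for u v
  proof -
    have "((x' - u)\<^sup>2 + (y' - v)\<^sup>2) - ((x - u)\<^sup>2 + (y - v)\<^sup>2)
        = ((2 * (x - x')) * u + (2 * (y - y')) * v) - (x\<^sup>2 + y\<^sup>2 - x'\<^sup>2 - y'\<^sup>2)"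
      by (simp add: power2_eq_square algebra_simps)
    then show ?thesis unfolding mem_Collect_eq case_prod_conv by (rule diff_eq_diff_eq)
  qed
  have "bij_betw (\<lambda>a. (a, (x - fst a)\<^sup>2 + (y - snd a)\<^sup>2)) ?L
          {c. p \<in> circle (fst c) (snd c) \<and> p' \<in> circle (fst c) (snd c)}"
  proof (intro bij_betwI[of _ _ _ fst])
    show "(\<lambda>a. (a, (x - fst a)\<^sup>2 + (y - snd a)\<^sup>2)) \<in> ?L \<rightarrow>
            {c. p \<in> circle (fst c) (snd c) \<and> p' \<in> circle (fst c) (snd c)}"
      using bis by (auto simp: circle_def p)
    show "fst \<in> {c. p \<in> circle (fst c) (snd c) \<and> p' \<in> circle (fst c) (snd c)} \<rightarrow> ?L"
    proof
      fix c assume "c \<in> {c. p \<in> circle (fst c) (snd c) \<and> p' \<in> circle (fst c) (snd c)}"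
      then have "(fst (fst c), snd (fst c)) \<in> ?L"
        by (subst bis[symmetric]) (simp add: circle_def p)
      then show "fst c \<in> ?L" by simp
    qed
  qed (auto simp: circle_def p)
  moreover have "card ?L = CARD('a)"
    using two \<open>p \<noteq> p'\<close> p by (intro card_line) auto
  ultimately show ?thesis by (simp add: bij_betw_same_card)
qed

section \<open>Collinear triples on circles\<close>

lemma quadratic_three_roots:
  fixes A B C :: "'a::field"
  assumes "A * x\<^sup>2 + B * x + C = 0" "A * y\<^sup>2 + B * y + C = 0" "A * z\<^sup>2 + B * z + C = 0"
    and "x \<noteq> y" "x \<noteq> z" "y \<noteq> z"
  shows "A = 0" "B = 0" "C = 0"
proof -
  \<comment> \<open>Subtracting the two equations and cancelling \<open>s - t\<close> leaves a
    linear relation; two such relations sharing the root \<open>x\<close> force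
    \<open>A = 0\<close>.\<close>
  have slope: "A * (s + t) + B = 0"
    if "A * s\<^sup>2 + B * s + C = 0" "A * t\<^sup>2 + B * t + C = 0" "s \<noteq> t" for s t
  proof -
    have "(s - t) * (A * (s + t) + B) = (A * s\<^sup>2 + B * s + C) - (A * t\<^sup>2 + B * t + C)"
      by (simp add: power2_eq_square algebra_simps)
    then show ?thesis using that by simp
  qed
  have *: "A * (x + y) + B = 0" "A * (x + z) + B = 0" by (intro slope assms)+
  have "A * (y - z) = (A * (x + y) + B) - (A * (x + z) + B)" by (simp add: algebra_simps)
  then have "A * (y - z) = 0" by (simp only: *) simp
  then show "A = 0" using assms by auto
  then show "B = 0" using * by simp
  then show "C = 0" using \<open>A = 0\<close> assms by simp
qed

text \<open>Since \<open>\<beta> \<noteq> 0\<close>, points of the line are told apart by their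
  first coordinates. Eliminating the second coordinate gives a quadratic with three distinct roots,
  so all its coefficients vanish.\<close>

lemma circle_line_three_points:
  fixes \<alpha> \<beta> \<gamma> r :: "'a::field"
  assumes two: "(2::'a) \<noteq> 0" and \<beta>: "\<beta> \<noteq> 0"
    and circ: "x1\<^sup>2 + y1\<^sup>2 = r" "x2\<^sup>2 + y2\<^sup>2 = r" "x3\<^sup>2 + y3\<^sup>2 = r"
    and line: "\<alpha> * x1 + \<beta> * y1 = \<gamma>" "\<alpha> * x2 + \<beta> * y2 = \<gamma>" "\<alpha> * x3 + \<beta> * y3 = \<gamma>"
    and dist: "(x1, y1) \<noteq> (x2, y2)" "(x1, y1) \<noteq> (x3, y3)" "(x2, y2) \<noteq> (x3, y3)"
  shows "r = 0"
proof -
  have "s \<noteq> s'" if "\<alpha> * s + \<beta> * t = \<gamma>" "\<alpha> * s' + \<beta> * t' = \<gamma>" "(s, t) \<noteq> (s', t')" for s t s' t'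
  proof
    assume "s = s'"
    with that(1,2) have "\<alpha> * s + \<beta> * t = \<alpha> * s + \<beta> * t'" by metis
    with \<beta> \<open>s = s'\<close> that(3) show False by simp
  qed
  then have "x1 \<noteq> x2" "x1 \<noteq> x3" "x2 \<noteq> x3" using line dist by blast+
  moreover have eq: "(\<alpha>\<^sup>2 + \<beta>\<^sup>2) * x\<^sup>2 + (- 2 * \<alpha> * \<gamma>) * x + (\<gamma>\<^sup>2 - r * \<beta>\<^sup>2) = 0"
    if "x\<^sup>2 + y\<^sup>2 = r" "\<alpha> * x + \<beta> * y = \<gamma>" for x y
  proof -
    have "(\<alpha>\<^sup>2 + \<beta>\<^sup>2) * x\<^sup>2 + (- 2 * \<alpha> * \<gamma>) * x + (\<gamma>\<^sup>2 - r * \<beta>\<^sup>2)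
        = (\<gamma> - \<alpha> * x)\<^sup>2 - \<beta>\<^sup>2 * (r - x\<^sup>2)"
      by (simp add: power2_eq_square algebra_simps)
    also have "\<dots> = (\<beta> * y)\<^sup>2 - \<beta>\<^sup>2 * y\<^sup>2" by (simp flip: that)
    finally show ?thesis by (simp add: power_mult_distrib)
  qed
  ultimately have "\<alpha>\<^sup>2 + \<beta>\<^sup>2 = 0" "- 2 * \<alpha> * \<gamma> = 0" "\<gamma>\<^sup>2 - r * \<beta>\<^sup>2 = 0"
    using quadratic_three_roots[OF eq eq eq, OF circ(1) line(1) circ(2) line(2) circ(3) line(3)]
    by blast+
  \<comment> \<open>Now \<open>\<alpha> \<noteq> 0\<close> and \<open>2 \<noteq> 0\<close> give
    \<open>\<gamma> = 0\<close>, and the constant coefficient reduces to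
    \<open>r * \<beta>\<^sup>2 = 0\<close>.\<close>
  moreover from this \<beta> have "\<alpha> \<noteq> 0" by auto
  ultimately show "r = 0" using two \<beta> by auto
qed

lemma not_collinear_on_circle:
  fixes r :: "'a::field"
  assumes two: "(2::'a) \<noteq> 0" and "r \<noteq> 0" and "T \<subseteq> circle a r" and "card T = 3"
  shows "\<not> collinear_points T"
proof
  assume "collinear_points T"
  then obtain \<alpha> \<beta> c where ab: "(\<alpha>, \<beta>) \<noteq> (0, 0)" and L: "T \<subseteq> {(x, y). \<alpha> * x + \<beta> * y = c}"
    by (auto simp: collinear_points_def is_line_def)
  obtain p1 p2 p3 where "T = {p1, p2, p3}" "p1 \<noteq> p2" "p1 \<noteq> p3" "p2 \<noteq> p3"
    using \<open>card T = 3\<close> by (auto simp: card_3_iff)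
  then obtain x1 y1 x2 y2 x3 y3 where T: "T = {(x1, y1), (x2, y2), (x3, y3)}"
    and dist: "(x1, y1) \<noteq> (x2, y2)" "(x1, y1) \<noteq> (x3, y3)" "(x2, y2) \<noteq> (x3, y3)"
    by (metis surj_pair)
  obtain u v where a: "a = (u, v)" by (metis surj_pair)
  \<comment> \<open>The centre is translated to the origin, which changes only the constant of the
    line.\<close>
  define \<gamma> where "\<gamma> = c - \<alpha> * u - \<beta> * v"
  have circ: "(x1 - u)\<^sup>2 + (y1 - v)\<^sup>2 = r" "(x2 - u)\<^sup>2 + (y2 - v)\<^sup>2 = r" "(x3 - u)\<^sup>2 + (y3 - v)\<^sup>2 = r"
    using assms(3) by (auto simp: T a circle_def)
  have line: "\<alpha> * (x1 - u) + \<beta> * (y1 - v) = \<gamma>" "\<alpha> * (x2 - u) + \<beta> * (y2 - v) = \<gamma>"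
    "\<alpha> * (x3 - u) + \<beta> * (y3 - v) = \<gamma>"
    using L by (auto simp: T \<gamma>_def algebra_simps)
  have "r = 0"
  proof (cases "\<beta> = 0")
    case False
    show ?thesis
      using dist by (intro circle_line_three_points[OF two False circ line]) auto
  next
    case True
    then have "\<alpha> \<noteq> 0" using ab by auto
    \<comment> \<open>The coordinates are exchanged, so that \<open>\<alpha>\<close> serves as the
      nonzero coefficient.\<close>
    show ?thesis
      using dist circ line
      by (intro circle_line_three_points[OF two \<open>\<alpha> \<noteq> 0\<close>,
            of "y1 - v" "x1 - u" r "y2 - v" "x2 - u" "y3 - v" "x3 - u" \<beta> \<gamma>])
        (auto simp: add.commute)
  qed
  with \<open>r \<noteq> 0\<close> show False ..
qed

section \<open>Circles of radius zero\<close>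

lemma sqrt_minus_one_if_circle_zero:
  fixes a :: "'a::field \<times> 'a"
  assumes "p \<in> circle a 0" "p \<noteq> a"
  shows "\<exists>i::'a. i\<^sup>2 = -1"
proof -
  define u v where "u = fst p - fst a" and "v = snd p - snd a"
  have "u\<^sup>2 + v\<^sup>2 = 0" "u \<noteq> 0 \<or> v \<noteq> 0"
    using assms by (auto simp: u_def v_def circle_def prod_eq_iff)
  then have "v \<noteq> 0" "u\<^sup>2 = - v\<^sup>2" by (auto simp: eq_neg_iff_add_eq_0)
  then have "(u / v)\<^sup>2 = -1" by (simp add: power_divide)
  then show ?thesis ..
qed

text \<open>A circle of radius 0 is the union of two lines through its centre, on which
  \<open>x + i * y\<close> and \<open>x - i * y\<close> respectively are constant. One line of the
  first kind holds two points of \<open>P\<close>, and \<open>P\<close> is too large to lie on it; a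
  line of the second kind through a point of \<open>P\<close> off it completes the circle.\<close>

lemma zero_in_determined_radii:
  fixes P :: "('a::{field,finite} \<times> 'a) set"
  assumes two: "(2::'a) \<noteq> 0" and i: "(i::'a)\<^sup>2 = -1" and P: "card P > CARD('a)"
  shows "0 \<in> determined_radii P"
proof -
  have i0: "i \<noteq> 0" using i by auto
  define f where "f = (\<lambda>(x, y). x + i * y)"
  have "\<not> inj_on f P"
    using card_inj_on_le[of f P UNIV] P by auto
  then obtain x y x' y' where p: "(x, y) \<in> P" "(x', y') \<in> P" "(x, y) \<noteq> (x', y')"
    and same: "x + i * y = x' + i * y'"
    by (auto simp: inj_on_def f_def)
  have yy: "y \<noteq> y'" using p(3) same by auto
  have "\<not> P \<subseteq> {(s, t). 1 * s + i * t = x + i * y}"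
    using card_mono[of "{(s, t). 1 * s + i * t = x + i * y}" P] P card_line[of 1 i "x + i * y"]
    by auto
  then obtain s t where st: "(s, t) \<in> P" "s + i * t \<noteq> x + i * y" by auto
  define w where "w = s - i * t"
  \<comment> \<open>The intersection of the two lines, found by solving the equations
    \<open>sum\<close> and \<open>diff\<close> below.\<close>
  define a where "a = ((x + i * y + w) / 2, (x + i * y - w) / (2 * i))"
  have sum: "fst a + i * snd a = x + i * y" and diff: "fst a - i * snd a = s - i * t"
  proof -
    have half: "z / 2 + z / 2 = z" for z :: 'a
      using two by (simp flip: add_divide_distrib mult_2)
    have "i * snd a = (x + i * y - w) / 2" using i0 by (simp add: a_def)
    then have "fst a + i * snd a = (x + i * y) / 2 + (x + i * y) / 2" "fst a - i * snd a = w / 2 + w / 2"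
      by (simp_all add: a_def add_divide_distrib diff_divide_distrib)
    then show "fst a + i * snd a = x + i * y" "fst a - i * snd a = s - i * t"
      by (simp_all only: half w_def)
  qed
  have factor: "(z - fst a)\<^sup>2 + (z' - snd a)\<^sup>2
      = ((z + i * z') - (fst a + i * snd a)) * ((z - i * z') - (fst a - i * snd a))" for z z'
  proof -
    have "((z + i * z') - (fst a + i * snd a)) * ((z - i * z') - (fst a - i * snd a))
        = (z - fst a)\<^sup>2 - i\<^sup>2 * (z' - snd a)\<^sup>2"
      by (simp add: power2_eq_square algebra_simps)
    then show ?thesis by (simp add: i)
  qed
  have "(x - fst a)\<^sup>2 + (y - snd a)\<^sup>2 = 0" unfolding factor sum by simp
  moreover have "(x' - fst a)\<^sup>2 + (y' - snd a)\<^sup>2 = 0" unfolding factor sum same by simp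
  moreover have "(s - fst a)\<^sup>2 + (t - snd a)\<^sup>2 = 0" unfolding factor diff by simp
  ultimately have "{(x, y), (x', y'), (s, t)} \<subseteq> circle a 0"
    by (auto simp: circle_def)
  moreover have "card {(x, y), (x', y'), (s, t)} = 3"
    using p(3) st(2) same by (auto simp: card_insert_if)
  moreover have "\<not> collinear_points {(x, y), (x', y'), (s, t)}"
  proof
    assume "collinear_points {(x, y), (x', y'), (s, t)}"
    then obtain \<alpha> \<beta> c where ab: "(\<alpha>, \<beta>) \<noteq> (0, 0)" and
      L: "\<alpha> * x + \<beta> * y = c" "\<alpha> * x' + \<beta> * y' = c" "\<alpha> * s + \<beta> * t = c"
      by (auto simp: collinear_points_def is_line_def)
    \<comment> \<open>A line through the first two points has normal vector proportional to
      \<open>(1, i)\<close>, hence is a level set of \<open>f\<close>, and that level set misses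
      \<open>(s, t)\<close>.\<close>
    have "(\<beta> - i * \<alpha>) * (y - y') = (\<alpha> * x + \<beta> * y) - (\<alpha> * x' + \<beta> * y')
        - \<alpha> * ((x + i * y) - (x' + i * y'))"
      by (simp add: algebra_simps)
    also have "\<dots> = 0" by (simp only: L same) simp
    finally have "(\<beta> - i * \<alpha>) * (y - y') = 0" .
    then have \<beta>: "\<beta> = i * \<alpha>" using yy by simp
    then have "\<alpha> \<noteq> 0" using ab by auto
    moreover have "\<alpha> * (s + i * t) = \<alpha> * (x + i * y)"
      using L(1,3) \<beta> by (simp add: algebra_simps)
    ultimately show False using st(2) by simp
  qed
  moreover have "{(x, y), (x', y'), (s, t)} \<subseteq> P" using p st by simp
  ultimately have "determined_by P (circle a 0)"
    unfolding determined_by_def by (intro exI[of _ "{(x, y), (x', y'), (s, t)}"] conjI)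
  then show ?thesis unfolding determined_radii_def by blast
qed

lemma radius_of_rich_circle:
  fixes P :: "('a::{field,finite} \<times> 'a) set"
  assumes two: "(2::'a) \<noteq> 0" and P: "card P > CARD('a)"
    and rich: "card (P \<inter> circle a r) \<ge> 3"
  shows "r \<in> determined_radii P"
proof -
  obtain T where T: "T \<subseteq> P \<inter> circle a r" "card T = 3"
    using obtain_subset_with_card_n[OF rich] by metis
  show ?thesis
  proof (cases "r = 0")
    case True
    \<comment> \<open>Here \<open>T\<close> itself may be collinear. It only supplies a point other
      than the centre, hence a square root of -1; the determined circle of radius 0 may be a
      different one.\<close>
    have "\<not> T \<subseteq> {a}" using T(2) card_mono[of "{a}" T] by auto
    then obtain i :: 'a where "i\<^sup>2 = -1"
      using sqrt_minus_one_if_circle_zero[of _ a] T(1) True by blast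
    then show ?thesis using zero_in_determined_radii[OF two _ P] True by simp
  next
    case False
    then show ?thesis
      using T not_collinear_on_circle[OF two False _ T(2)]
      unfolding determined_radii_def determined_by_def by blast
  qed
qed

section \<open>First and second moments of the incidence count\<close>

lemma card_Int_eq_sum_of_bool:
  assumes "finite P"
  shows "real (card (P \<inter> S)) = (\<Sum>p\<in>P. of_bool (p \<in> S))"
  using assms by (simp add: of_bool_def sum.If_cases Int_def)

lemma sum_incidences:
  fixes P :: "('a::{field,finite} \<times> 'a) set"
  shows "(\<Sum>c\<in>UNIV. real (card (P \<inter> circle (fst c) (snd c)))) = real (card P) * real CARD('a) ^ 2"
proof -
  have "(\<Sum>c\<in>UNIV. real (card (P \<inter> circle (fst c) (snd c))))
      = (\<Sum>p\<in>P. \<Sum>c\<in>UNIV. of_bool (p \<in> circle (fst c) (snd c)))"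
    unfolding card_Int_eq_sum_of_bool[OF finite] by (rule sum.swap)
  also have "\<dots> = (\<Sum>p\<in>P. real (card {c. p \<in> circle (fst c) (snd c)}))"
    by (simp add: of_bool_def sum.If_cases)
  finally show ?thesis by (simp add: card_circles_through_point)
qed

text \<open>The square counts ordered pairs of points of \<open>P\<close> on a circle. After
  exchanging sums, a diagonal pair contributes \<open>q\<^sup>2\<close> and any other pair
  \<open>q\<close>, where \<open>q\<close> is the field size.\<close>

lemma sum_incidences_squared:
  fixes P :: "('a::{field,finite} \<times> 'a) set"
  assumes two: "(2::'a) \<noteq> 0"
  shows "(\<Sum>c\<in>UNIV. (real (card (P \<inter> circle (fst c) (snd c))))\<^sup>2)
    = real (card P) * real CARD('a) ^ 2 + real (card P) * (real (card P) - 1) * real CARD('a)"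
proof -
  let ?J = "\<lambda>p p'. card {c. p \<in> circle (fst c) (snd c) \<and> p' \<in> circle (fst c) (snd c)}"
  have "(\<Sum>c\<in>UNIV. (real (card (P \<inter> circle (fst c) (snd c))))\<^sup>2)
      = (\<Sum>c\<in>UNIV. \<Sum>p\<in>P. \<Sum>p'\<in>P.
          of_bool (p \<in> circle (fst c) (snd c) \<and> p' \<in> circle (fst c) (snd c)))"
    unfolding card_Int_eq_sum_of_bool[OF finite] power2_eq_square sum_product of_bool_conj ..
  also have "\<dots> = (\<Sum>p\<in>P. \<Sum>p'\<in>P. \<Sum>c\<in>UNIV.
          of_bool (p \<in> circle (fst c) (snd c) \<and> p' \<in> circle (fst c) (snd c)))"
    by (subst sum.swap, intro sum.cong refl, rule sum.swap)
  also have "\<dots> = (\<Sum>p\<in>P. \<Sum>p'\<in>P. real (?J p p'))"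
    by (simp add: of_bool_def sum.If_cases)
  also have "\<dots> = (\<Sum>p\<in>P. real CARD('a) ^ 2 + (real (card P) - 1) * real CARD('a))"
  proof (intro sum.cong refl)
    fix p assume "p \<in> P"
    then have "(\<Sum>p'\<in>P. real (?J p p')) = real (?J p p) + (\<Sum>p'\<in>P - {p}. real (?J p p'))"
      by (intro sum.remove) auto
    also have "(\<Sum>p'\<in>P - {p}. real (?J p p')) = (\<Sum>p'\<in>P - {p}. real CARD('a))"
      by (intro sum.cong refl arg_cong[where f = real] card_circles_through_two_points[OF two]) auto
    also have "\<dots> = (real (card P) - 1) * real CARD('a)"
    proof -
      have "card P > 0" using \<open>p \<in> P\<close> by (auto simp: card_gt_0_iff)
      then show ?thesis using \<open>p \<in> P\<close> by (simp add: card_Diff_singleton of_nat_diff)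
    qed
    finally show "(\<Sum>p'\<in>P. real (?J p p')) = real CARD('a) ^ 2 + (real (card P) - 1) * real CARD('a)"
      by (simp add: card_circles_through_point)
  qed
  finally show ?thesis by (simp add: algebra_simps)
qed

section \<open>Chebyshev estimate and passage to radii\<close>

lemma card_rich_circles:
  fixes P :: "('a::{field,finite} \<times> 'a) set"
  assumes two: "(2::'a) \<noteq> 0" and P: "card P = 5 * CARD('a)"
  shows "9 * real (card {c. card (P \<inter> circle (fst c) (snd c)) \<ge> 3}) \<ge> 4 * real CARD('a) ^ 3"
proof -
  define q where "q = real CARD('a)"
  define N where "N = (\<lambda>c. real (card (P \<inter> circle (fst c) (snd c))))"
  define G where "G = {c. card (P \<inter> circle (fst c) (snd c)) \<ge> 3}"
  have card_UNIV: "real CARD(('a \<times> 'a) \<times> 'a) = q ^ 3"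
    by (simp add: q_def power3_eq_cube)
  have "9 * real (card (- G)) = (\<Sum>c\<in>- G. 9)" by simp
  also have "\<dots> \<le> (\<Sum>c\<in>- G. (N c - 5)\<^sup>2)"
  proof (rule sum_mono)
    fix c assume "c \<in> - G"
    then have "3 \<le> 5 - N c" by (auto simp: G_def N_def)
    then have "3\<^sup>2 \<le> (5 - N c)\<^sup>2" by (intro power_mono) auto
    then show "9 \<le> (N c - 5)\<^sup>2" by (simp add: power2_commute)
  qed
  also have "\<dots> \<le> (\<Sum>c\<in>UNIV. (N c - 5)\<^sup>2)" by (intro sum_mono2) auto
  also have "\<dots> = (\<Sum>c\<in>UNIV. (N c)\<^sup>2) - 10 * (\<Sum>c\<in>UNIV. N c) + 25 * q ^ 3"
    by (simp add: power2_diff sum.distrib sum_subtractf flip: card_UNIV sum_distrib_left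
        sum_distrib_right)
  \<comment> \<open>With \<open>5 * q\<close> points the first moment is \<open>5 * q ^ 3\<close>
    and the second is \<open>30 * q ^ 3 - 5 * q ^ 2\<close>.\<close>
  also have "\<dots> = 5 * q ^ 3 - 5 * q ^ 2"
    unfolding N_def sum_incidences sum_incidences_squared[OF two]
    by (simp add: P q_def[symmetric]) (simp add: algebra_simps power2_eq_square power3_eq_cube)
  finally have "9 * real (card (- G)) \<le> 5 * q ^ 3" by (smt (verit) zero_le_power2)
  moreover have "real (card G) + real (card (- G)) = q ^ 3"
    using card_UNIV card_Un_disjoint[of G "- G"]
    by (simp add: Compl_partition del: card_prod flip: of_nat_add)
  ultimately show ?thesis unfolding G_def q_def by linarith
qed

theorem theorem1p12:
  fixes P :: "('a::{field,finite} \<times> 'a) set" and q :: nat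
  assumes "q = CARD('a)" and "primepow q" and "odd q"
    and "card P = 5 * q"
  shows "real (card (determined_radii P)) \<ge> 4 * real q / 9"
proof -
  have two: "(2::'a) \<noteq> 0" using assms two_neq_zero_if_odd_card by blast
  have q: "q > 0" using assms(1) by simp
  let ?G = "{c. card (P \<inter> circle (fst c) (snd c)) \<ge> 3}"
  \<comment> \<open>A circle with at least three points of \<open>P\<close> has a determined radius,
    though it need not be determined itself if the radius is 0. The centre is left unrestricted, at
    the cost of a factor \<open>q\<^sup>2\<close>.\<close>
  have "?G \<subseteq> UNIV \<times> determined_radii P"
    using radius_of_rich_circle[OF two, of P] assms q by auto
  then have "card ?G \<le> card ((UNIV :: ('a \<times> 'a) set) \<times> determined_radii P)"
    by (intro card_mono) auto
  then have "card ?G \<le> q\<^sup>2 * card (determined_radii P)"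
    by (simp add: card_cartesian_product assms(1) power2_eq_square)
  then have "real (card ?G) \<le> real (q\<^sup>2 * card (determined_radii P))"
    by (rule of_nat_mono)
  then have "real (card ?G) \<le> (real q)\<^sup>2 * real (card (determined_radii P))"
    by simp
  moreover have "4 * real q ^ 3 \<le> 9 * real (card ?G)"
    using card_rich_circles[OF two, of P] assms(1,4) by simp
  ultimately have "4 * real q ^ 3 \<le> 9 * ((real q)\<^sup>2 * real (card (determined_radii P)))"
    by linarith
  then have "(real q)\<^sup>2 * (4 * real q) \<le> (real q)\<^sup>2 * (9 * real (card (determined_radii P)))"
    by (simp only: power2_eq_square power3_eq_cube mult_ac)
  then have "4 * real q \<le> 9 * real (card (determined_radii P))"
    by (rule mult_left_le_imp_le) (use q in simp)
  then show ?thesis by simp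
qed

end
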